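(* Let $n\ge 1$ and let $X\subseteq\mathbb{FT}^n$ be a tropical polytope of generator dimension $n$ and dual dimension $n$. Then $X$ is a projective $\mathbb{FT}$-module if and only if $X$ is min-plus convex (as well as max-plus convex).
   Context: $\mathbb{FT}$ is the finitary tropical semiring: the set $\mathbb{R}$ with $a \oplus b = \max(a,b)$ and $a \otimes b = ab = a+b$ (usual addition); its multiplicative identity is the real number $0$. An $\mathbb{FT}$-module is a commutative semigroup $(M,\oplus)$ with a left action of $\mathbb{FT}$ satisfying $\lambda(\mu m) = (\lambda\mu)m$, $(\lambda\oplus\mu)m = \lambda m\oplus\mu m$, $\lambda(m\oplus m') = \lambda m\oplus\lambda m'$ and $0m = m$. Morphisms are maps preserving $\oplus$ and the action. $\mathbb{FT}^n$ is an $\mathbb{FT}$-module under componentwise maximum and $(\lambda x)_i = \lambda + x_i$, and is partially ordered componentwise. A tropical polytope in $\mathbb{FT}^n$ is a non-empty finitely generated submodule of $\mathbb{FT}^n$ (generated under $\oplus$ and scaling by $\mathbb{FT}$). A subset of $\mathbb{FT}^n$ is max-plus convex if it is closed under $\oplus$ and scaling by $\mathbb{FT}$ (this holds automatically for polytopes), and min-plus convex if it is closed under componentwise minimum and scaling by $\mathbb{FT}$. A module $P$ is projective if for every morphism $g : P \to M$ and every surjective morphism $f : A \to M$ of $\mathbb{FT}$-modules there is a morphism $p : P \to A$ with $f \circ p = g$. The generator dimension of $X$ is the minimal cardinality of a generating set of $X$ under scaling and $\oplus$. The dual dimension of $X$ is the minimal cardinality of a generating set of $X$ under scaling and the operation of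 greatest lower bound within the poset $X$ (which may differ from the componentwise minimum). *)

theory Defs
  imports "HOL-Analysis.Analysis" "HOL-Library.Extended_Nat"
begin

text \<open>
  The finitary tropical semiring is the type \<^typ>\<open>real\<close> with semiring addition \<^const>\<open>max\<close>,
  semiring multiplication \<^term>\<open>(+) :: real \<Rightarrow> real \<Rightarrow> real\<close> and multiplicative identity \<open>0\<close>.
\<close>

record 'a ft_struct =
  mcarrier :: "'a set"
  madd :: "'a \<Rightarrow> 'a \<Rightarrow> 'a"
  mscale :: "real \<Rightarrow> 'a \<Rightarrow> 'a"

definition ft_module :: "'a ft_struct \<Rightarrow> bool" where
  "ft_module M \<longleftrightarrow>
     (\<forall>x\<in>mcarrier M. \<forall>y\<in>mcarrier M. madd M x y \<in> mcarrier M) \<and>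
     (\<forall>x\<in>mcarrier M. \<forall>y\<in>mcarrier M. \<forall>z\<in>mcarrier M.
        madd M (madd M x y) z = madd M x (madd M y z)) \<and>
     (\<forall>x\<in>mcarrier M. \<forall>y\<in>mcarrier M. madd M x y = madd M y x) \<and>
     (\<forall>a. \<forall>x\<in>mcarrier M. mscale M a x \<in> mcarrier M) \<and>
     (\<forall>a b. \<forall>x\<in>mcarrier M. mscale M a (mscale M b x) = mscale M (a + b) x) \<and>
     (\<forall>a b. \<forall>x\<in>mcarrier M. mscale M (max a b) x = madd M (mscale M a x) (mscale M b x)) \<and>
     (\<forall>a. \<forall>x\<in>mcarrier M. \<forall>y\<in>mcarrier M.
        mscale M a (madd M x y) = madd M (mscale M a x) (mscale M a y)) \<and>
     (\<forall>x\<in>mcarrier M. mscale M 0 x = x)"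

definition ft_hom :: "'a ft_struct \<Rightarrow> 'b ft_struct \<Rightarrow> ('a \<Rightarrow> 'b) set" where
  "ft_hom M N = {f. f ` mcarrier M \<subseteq> mcarrier N \<and>
     (\<forall>x\<in>mcarrier M. \<forall>y\<in>mcarrier M. f (madd M x y) = madd N (f x) (f y)) \<and>
     (\<forall>a. \<forall>x\<in>mcarrier M. f (mscale M a x) = mscale N a (f x))}"

text \<open>
  A HOL formula cannot quantify over types, so the test modules \<open>A\<close> and \<open>M\<close> of projectivity range
  over all modules whose carrier is a set in the type \<open>'u\<close>, a parameter playing the role of a
  universe. Projectivity with respect to \<open>'u\<close> entails projectivity with respect to every type that
  injects into \<open>'u\<close>; a result covering all modules should hold for all sufficiently large \<open>'u\<close>.
\<close>

definition ft_projective :: "'u itself \<Rightarrow> 'a ft_struct \<Rightarrow> bool" where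
  "ft_projective (_ :: 'u itself) P \<longleftrightarrow> ft_module P \<and>
     (\<forall>(A :: 'u ft_struct) (M :: 'u ft_struct). ft_module A \<and> ft_module M \<longrightarrow>
        (\<forall>g \<in> ft_hom P M. \<forall>f \<in> ft_hom A M. f ` mcarrier A = mcarrier M \<longrightarrow>
           (\<exists>p \<in> ft_hom P A. \<forall>x\<in>mcarrier P. f (p x) = g x)))"

definition tscale :: "real \<Rightarrow> real ^ 'n \<Rightarrow> real ^ 'n" where
  "tscale a x = (\<chi> i. a + x $ i)"

text \<open>
  On \<^typ>\<open>real ^ 'n\<close> the library's \<^const>\<open>sup\<close>, \<^const>\<open>inf\<close> and \<open>\<le>\<close> are componentwise
  (\<open>sup_vec_def\<close>, \<open>inf_vec_def\<close>, \<open>less_eq_vec_def\<close>).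
\<close>

definition max_plus_convex :: "(real ^ 'n) set \<Rightarrow> bool" where
  "max_plus_convex X \<longleftrightarrow> (\<forall>x\<in>X. \<forall>y\<in>X. sup x y \<in> X) \<and> (\<forall>a. \<forall>x\<in>X. tscale a x \<in> X)"

definition min_plus_convex :: "(real ^ 'n) set \<Rightarrow> bool" where
  "min_plus_convex X \<longleftrightarrow> (\<forall>x\<in>X. \<forall>y\<in>X. inf x y \<in> X) \<and> (\<forall>a. \<forall>x\<in>X. tscale a x \<in> X)"

text \<open>The submodule of \<^typ>\<open>real ^ 'n\<close> carried by \<open>X\<close>; it is a module when \<open>X\<close> is max-plus convex.\<close>

definition ft_submodule :: "(real ^ 'n) set \<Rightarrow> (real ^ 'n) ft_struct" where
  "ft_submodule X = \<lparr>mcarrier = X, madd = sup, mscale = tscale\<rparr>"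

definition generates :: "(real ^ 'n) set \<Rightarrow> (real ^ 'n) set \<Rightarrow> bool" where
  "generates S X \<longleftrightarrow> max_plus_convex hull S = X"

definition tropical_polytope :: "(real ^ 'n) set \<Rightarrow> bool" where
  "tropical_polytope X \<longleftrightarrow> X \<noteq> {} \<and> (\<exists>S. finite S \<and> generates S X)"

text \<open>The dimensions are \<^term>\<open>\<infinity> :: enat\<close> if there is no finite generating set.\<close>

definition generator_dimension :: "(real ^ 'n) set \<Rightarrow> enat" where
  "generator_dimension X = Inf {enat (card S) | S. finite S \<and> generates S X}"

definition is_glb_in :: "'a::order set \<Rightarrow> 'a \<Rightarrow> 'a \<Rightarrow> 'a \<Rightarrow> bool" where
  "is_glb_in X x y z \<longleftrightarrow>
     z \<in> X \<and> z \<le> x \<and> z \<le> y \<and> (\<forall>w\<in>X. w \<le> x \<and> w \<le> y \<longrightarrow> w \<le> z)"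

text \<open>
  Closure under scaling and under the greatest lower bound in the poset \<open>X\<close>. The latter exists for
  any two elements of a tropical polytope, but in general lies below the componentwise minimum.
\<close>

definition dual_closed :: "(real ^ 'n) set \<Rightarrow> (real ^ 'n) set \<Rightarrow> bool" where
  "dual_closed X T \<longleftrightarrow>
     (\<forall>x\<in>T. \<forall>y\<in>T. \<forall>z. is_glb_in X x y z \<longrightarrow> z \<in> T) \<and> (\<forall>a. \<forall>x\<in>T. tscale a x \<in> T)"

definition dual_generates :: "(real ^ 'n) set \<Rightarrow> (real ^ 'n) set \<Rightarrow> bool" where
  "dual_generates S X \<longleftrightarrow> dual_closed X hull S = X"

definition dual_dimension :: "(real ^ 'n) set \<Rightarrow> enat" where
  "dual_dimension X = Inf {enat (card S) | S. finite S \<and> dual_generates S X}"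

end

theory Submission
  imports Defs
begin

text \<open>
  If \<open>X\<close> is min-plus convex, then for each coordinate \<open>k\<close> it has a least element \<open>u k\<close> with
  \<open>k\<close>-th coordinate \<open>0\<close>, and every \<open>x\<close> in \<open>X\<close> is the maximum of the vectors \<open>x\<^sub>k + u k\<close>.
  These coefficients depend linearly on \<open>x\<close>, so morphisms out of \<open>X\<close> lift.

  Conversely, let \<open>G\<close> be the matrix of a minimal generating set. Projectivity gives a linear section
  \<open>p\<close> of the surjection \<open>G\<close> onto \<open>X\<close>. Put \<open>P = p G\<close>; minimality makes its diagonal zero, so
  \<open>P\<close> is a Kleene star and \<open>p\<close> maps \<open>X\<close> onto the min-plus convex set
  \<open>{y. \<forall>k j. P k j + y j \<le> y k}\<close>. Each row of \<open>P\<close> is a scaling of a row of \<open>G\<close>, distinct rows of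
  \<open>P\<close> coming from distinct rows of \<open>G\<close>. Since \<open>G\<close> is square, the inverse of \<open>p\<close> merely permutes and
  shifts coordinates, so \<open>X\<close> is min-plus convex as well.
\<close>

section \<open>Tropical linear combinations and max-plus hulls\<close>

text \<open>Max-plus matrix-vector product with columns \<open>G j\<close>. No tropical zero exists
  to switch a column off, so columns are selected through \<open>K\<close>, which must be nonempty
  for \<open>Max\<close> to be meaningful.\<close>

definition tcomb :: "('k \<Rightarrow> real ^ 'n) \<Rightarrow> 'k set \<Rightarrow> ('k \<Rightarrow> real) \<Rightarrow> real ^ 'n" where
  "tcomb G K l = (\<chi> i. Max ((\<lambda>j. l j + G j $ i) ` K))"

lemma tscale_nth [simp]: "tscale a x $ i = a + x $ i"
  by (simp add: tscale_def)

lemma sup_vec_nth [simp]: "sup x y $ i = max (x $ i) (y $ i :: real)"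
  by (simp add: sup_vec_def sup_real_def)

lemma inf_vec_nth [simp]: "inf x y $ i = min (x $ i) (y $ i :: real)"
  by (simp add: inf_vec_def inf_real_def)

lemma tcomb_ge: "finite K \<Longrightarrow> j \<in> K \<Longrightarrow> l j + G j $ i \<le> tcomb G K l $ i"
  by (auto simp: tcomb_def)

lemma tcomb_attained:
  assumes "finite K" "K \<noteq> {}"
  obtains j where "j \<in> K" "tcomb G K l $ i = l j + G j $ i"
proof -
  have "Max ((\<lambda>j. l j + G j $ i) ` K) \<in> (\<lambda>j. l j + G j $ i) ` K"
    using assms by (intro Max_in) auto
  then show ?thesis
    using that by (auto simp: tcomb_def)
qed

lemma tcomb_le_iff:
  "finite K \<Longrightarrow> K \<noteq> {} \<Longrightarrow> tcomb G K l $ i \<le> c \<longleftrightarrow> (\<forall>j\<in>K. l j + G j $ i \<le> c)"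
  by (auto simp: tcomb_def)

lemma tcomb_nth_eqI:
  assumes "finite K" "K \<noteq> {}" "\<And>j. j \<in> K \<Longrightarrow> l j + G j $ i \<le> c" "k \<in> K" "l k + G k $ i = c"
  shows "tcomb G K l $ i = c"
  using tcomb_ge[of K k l G i] tcomb_le_iff[of K G l i c] assms by (simp add: order_antisym)

lemma tcomb_singleton: "tcomb G {k} l = tscale (l k) (G k)"
  by (simp add: tcomb_def vec_eq_iff)

lemma tcomb_insert:
  "finite K \<Longrightarrow> K \<noteq> {} \<Longrightarrow> tcomb G (insert k K) l = sup (tscale (l k) (G k)) (tcomb G K l)"
  by (simp add: tcomb_def vec_eq_iff)

lemma tcomb_sup:
  assumes "finite K" "K \<noteq> {}"
  shows "sup (tcomb G K l) (tcomb G K m) = tcomb G K (\<lambda>j. max (l j) (m j))"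
  using assms
proof (induction K rule: finite_ne_induct)
  case (singleton k)
  then show ?case by (simp add: tcomb_singleton vec_eq_iff max_def)
next
  case (insert k K)
  show ?case
    using insert.hyps
    by (simp add: tcomb_insert insert.IH[symmetric]) (auto simp: vec_eq_iff max_def)
qed

lemma tscale_tcomb:
  assumes "finite K" "K \<noteq> {}"
  shows "tscale a (tcomb G K l) = tcomb G K (\<lambda>j. a + l j)"
  using assms
proof (induction K rule: finite_ne_induct)
  case (singleton k)
  then show ?case by (simp add: tcomb_singleton vec_eq_iff)
next
  case (insert k K)
  show ?case
    using insert.hyps
    by (simp add: tcomb_insert insert.IH[symmetric]) (auto simp: vec_eq_iff max_def)
qed

lemma max_plus_convex_tcomb:
  assumes "finite K" "K \<noteq> {}" "max_plus_convex X" "G ` K \<subseteq> X"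
  shows "tcomb G K l \<in> X"
  using assms
proof (induction K rule: finite_ne_induct)
  case (singleton k)
  then show ?case by (simp add: tcomb_singleton max_plus_convex_def)
next
  case (insert k K)
  then show ?case by (simp add: tcomb_insert max_plus_convex_def)
qed

lemma max_plus_convex_hull: "max_plus_convex (max_plus_convex hull S)"
  by (rule hull_in) (auto simp: max_plus_convex_def)

lemma max_plus_convex_hull_image:
  fixes G :: "'k \<Rightarrow> real ^ 'n"
  assumes "finite K" "K \<noteq> {}"
  shows "max_plus_convex hull (G ` K) = range (tcomb G K)"
proof (rule hull_unique)
  show "G ` K \<subseteq> range (tcomb G K)"
  proof
    fix x assume "x \<in> G ` K"
    then obtain k where k: "k \<in> K" "x = G k" by auto
    define l where "l j = (if j = k then 0 else Min (range (\<lambda>i. G k $ i - G j $ i)))" for j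
    have "l j + G j $ i \<le> G k $ i" for i j
    proof -
      have "Min (range (\<lambda>i. G k $ i - G j $ i)) \<le> G k $ i - G j $ i" by (rule Min_le) auto
      then have "Min (range (\<lambda>i. G k $ i - G j $ i)) + G j $ i \<le> G k $ i" by linarith
      then show ?thesis by (simp add: l_def)
    qed
    then have "tcomb G K l = x"
      using assms k by (auto simp: vec_eq_iff l_def intro!: tcomb_nth_eqI[where k = k])
    then show "x \<in> range (tcomb G K)" by blast
  qed
  show "max_plus_convex (range (tcomb G K))"
    by (auto simp: max_plus_convex_def tcomb_sup tscale_tcomb assms)
  show "range (tcomb G K) \<subseteq> T" if "G ` K \<subseteq> T" "max_plus_convex T" for T
    using max_plus_convex_tcomb assms that by blast
qed

section \<open>Submodules of the real vectors and their morphisms\<close>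

lemma ft_module_submodule: "max_plus_convex X \<Longrightarrow> ft_module (ft_submodule X)"
  by (auto simp: ft_module_def ft_submodule_def max_plus_convex_def vec_eq_iff)

lemma tropical_polytope_max_plus_convex: "tropical_polytope X \<Longrightarrow> max_plus_convex X"
  using max_plus_convex_hull by (auto simp: tropical_polytope_def generates_def)

lemma hom_tcomb:
  assumes "p \<in> ft_hom (ft_submodule X) (ft_submodule Y)" "max_plus_convex X"
    and "finite K" "K \<noteq> {}" "G ` K \<subseteq> X"
  shows "p (tcomb G K l) = tcomb (\<lambda>k. p (G k)) K l"
  using assms(3,4,5)
proof (induction K rule: finite_ne_induct)
  case (singleton k)
  then show ?case using assms(1) by (simp add: tcomb_singleton ft_hom_def ft_submodule_def)
next
  case (insert k K)
  have "tcomb G K l \<in> X" "tscale (l k) (G k) \<in> X"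
    using insert assms(2) max_plus_convex_tcomb[of K X G l] by (auto simp: max_plus_convex_def)
  then show ?case
    using insert assms(1) by (simp add: tcomb_insert ft_hom_def ft_submodule_def)
qed

section \<open>Change of universe\<close>

definition transport :: "('a \<Rightarrow> 'b) \<Rightarrow> 'a ft_struct \<Rightarrow> 'b ft_struct" where
  "transport e M = \<lparr>mcarrier = e ` mcarrier M,
     madd = (\<lambda>x y. e (madd M (inv e x) (inv e y))), mscale = (\<lambda>a x. e (mscale M a (inv e x)))\<rparr>"

lemma ft_module_transport: "inj e \<Longrightarrow> ft_module M \<Longrightarrow> ft_module (transport e M)"
  unfolding ft_module_def transport_def by simp metis

text \<open>Test modules are moved into \<open>'u\<close> along \<open>e\<close>, the lift is found
  there, and \<open>inv e\<close> brings it back.\<close>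

lemma ft_projective_mono:
  assumes e: "inj (e :: 'b \<Rightarrow> 'u)" and P: "ft_projective TYPE('u) P"
  shows "ft_projective TYPE('b) P"
  unfolding ft_projective_def
proof (intro conjI allI impI ballI)
  show "ft_module P" using P by (simp add: ft_projective_def)
  fix A M :: "'b ft_struct" and g f
  assume AM: "ft_module A \<and> ft_module M" and g: "g \<in> ft_hom P M" and f: "f \<in> ft_hom A M"
    and surj: "f ` mcarrier A = mcarrier M"
  have g': "e \<circ> g \<in> ft_hom P (transport e M)"
    using g e by (auto simp: ft_hom_def transport_def)
  have f': "e \<circ> f \<circ> inv e \<in> ft_hom (transport e A) (transport e M)"
    using f e by (auto simp: ft_hom_def transport_def)
  have surj': "(e \<circ> f \<circ> inv e) ` mcarrier (transport e A) = mcarrier (transport e M)"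
    using e by (simp add: transport_def image_image surj[symmetric])
  obtain p where p: "p \<in> ft_hom P (transport e A)" 
      "\<forall>x\<in>mcarrier P. (e \<circ> f \<circ> inv e) (p x) = (e \<circ> g) x"
    using P AM g' f' surj' ft_module_transport[OF e] unfolding ft_projective_def by metis
  have "inv e \<circ> p \<in> ft_hom P A"
    using p(1) e by (fastforce simp: ft_hom_def transport_def)
  moreover have "\<forall>x\<in>mcarrier P. f ((inv e \<circ> p) x) = g x"
    using p(2) e by (auto dest: injD)
  ultimately show "\<exists>p\<in>ft_hom P A. \<forall>x\<in>mcarrier P. f (p x) = g x" by blast
qed

text \<open>Dedekind cuts: a vector is determined by the rationals below each coordinate, that is,
  by a subset of a countable set, and the sets of naturals are equinumerous with the reals.\<close>

lemma inj_vec_real: "\<exists>e :: real ^ 'n \<Rightarrow> real. inj e"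
proof -
  define c :: "real ^ 'n \<Rightarrow> ('n \<times> rat) set" where "c x = {(i, q). of_rat q < x $ i}" for x
  have "inj c"
  proof (rule injI)
    fix x y assume eq: "c x = c y"
    have "of_rat q < x $ i \<longleftrightarrow> of_rat q < y $ i" for i q
      using eq by (auto simp: c_def set_eq_iff)
    then have "x $ i = y $ i" for i
      by (metis less_asym linorder_neqE_linordered_idom of_rat_dense)
    then show "x = y" by (simp add: vec_eq_iff)
  qed
  moreover have "countable (UNIV :: ('n \<times> rat) set)"
    by (metis UNIV_Times_UNIV countable_SIGMA countable_finite finite countableI_type)
  then obtain t :: "'n \<times> rat \<Rightarrow> nat" where "inj t" by (auto simp: countable_def)
  then have "inj (image t)" by (simp add: inj_image_eq_iff inj_def)
  moreover obtain r :: "nat set \<Rightarrow> real" where "inj r"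
    using nat_sets_eqpoll_reals by (auto simp: eqpoll_def bij_betw_def)
  ultimately show ?thesis by (metis inj_compose)
qed

section \<open>Calculus in abstract modules and lifting of combinations\<close>

lemma ft_moduleD:
  assumes "ft_module M" "x \<in> mcarrier M" "y \<in> mcarrier M"
  shows ft_module_add_closed: "madd M x y \<in> mcarrier M"
    and ft_module_assoc: "z \<in> mcarrier M \<Longrightarrow> madd M (madd M x y) z = madd M x (madd M y z)"
    and ft_module_commute: "madd M x y = madd M y x"
    and ft_module_scale_add: "mscale M a (madd M x y) = madd M (mscale M a x) (mscale M a y)"
  using assms unfolding ft_module_def by blast+

lemma ft_module_scaleD:
  assumes "ft_module M" "x \<in> mcarrier M"
  shows ft_module_scale_closed: "mscale M a x \<in> mcarrier M"
    and ft_module_scale_scale: "mscale M a (mscale M b x) = mscale M (a + b) x"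
    and ft_module_max_scale: "mscale M (max a b) x = madd M (mscale M a x) (mscale M b x)"
  using assms by (simp_all add: ft_module_def)

text \<open>Serves to show that a sum of two morphisms is additive.\<close>

lemma ft_module_interchange:
  assumes M: "ft_module M"
    and "v \<in> mcarrier M" "w \<in> mcarrier M" "y \<in> mcarrier M" "z \<in> mcarrier M"
  shows "madd M (madd M v w) (madd M y z) = madd M (madd M v y) (madd M w z)"
proof -
  have "madd M (madd M v w) (madd M y z) = madd M v (madd M (madd M w y) z)"
    using assms by (simp add: ft_module_assoc ft_module_add_closed)
  also have "madd M w y = madd M y w" using assms by (intro ft_module_commute)
  also have "madd M v (madd M (madd M y w) z) = madd M (madd M v y) (madd M w z)"
    using assms by (simp add: ft_module_assoc ft_module_add_closed)
  finally show ?thesis .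
qed

text \<open>Choose a preimage of each \<open>g (u k)\<close> and send \<open>x\<close> to the sum of
  these preimages scaled by \<open>x $ k\<close>. A semigroup has no empty sum, so the induction
  starts at a single index.\<close>

lemma combination_hom:
  assumes "finite K" "K \<noteq> {}" and X: "max_plus_convex X" and u: "u ` K \<subseteq> X"
    and A: "ft_module A" and f: "f \<in> ft_hom A M" and surj: "f ` mcarrier A = mcarrier M"
    and g: "g \<in> ft_hom (ft_submodule X) M"
  shows "\<exists>p\<in>ft_hom (ft_submodule UNIV) A. \<forall>x :: real ^ 'k. f (p x) = g (tcomb u K (\<lambda>j. x $ j))"
  using assms(1,2) u
proof (induction K rule: finite_ne_induct)
  case (singleton k)
  then have "g (u k) \<in> f ` mcarrier A"
    using g surj by (auto simp: ft_hom_def ft_submodule_def)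
  then obtain a where a: "a \<in> mcarrier A" "f a = g (u k)" by auto
  define p where "p x = mscale A (x $ k) a" for x :: "real ^ 'k"
  have "p \<in> ft_hom (ft_submodule UNIV) A"
    using A a by (auto simp: ft_hom_def ft_submodule_def p_def ft_module_def)
  moreover have "f (p x) = g (tcomb u {k} (\<lambda>j. x $ j))" for x
    using a f g singleton by (auto simp: ft_hom_def ft_submodule_def p_def tcomb_singleton)
  ultimately show ?case by blast
next
  case (insert k K)
  then obtain p where p: "p \<in> ft_hom (ft_submodule UNIV) A"
      "\<And>x. f (p x) = g (tcomb u K (\<lambda>j. x $ j))" by auto
  have uX: "u k \<in> X" "tscale (x $ k) (u k) \<in> X" "tcomb u K (\<lambda>j. x $ j) \<in> X" for x :: "real ^ 'k"
    using insert X max_plus_convex_tcomb[of K X u] by (auto simp: max_plus_convex_def)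
  then have "g (u k) \<in> f ` mcarrier A"
    using g surj by (auto simp: ft_hom_def ft_submodule_def)
  then obtain a where a: "a \<in> mcarrier A" "f a = g (u k)" by auto
  define q where "q x = madd A (mscale A (x $ k) a) (p x)" for x
  have pA: "p x \<in> mcarrier A" "mscale A s a \<in> mcarrier A" for x s
    using p(1) A a by (auto simp: ft_hom_def ft_submodule_def ft_module_scale_closed)
  have "q x \<in> mcarrier A" for x
    unfolding q_def by (intro ft_module_add_closed A pA)
  moreover have "q (sup x y) = madd A (q x) (q y)" for x y
  proof -
    have "q (sup x y) = madd A (madd A (mscale A (x $ k) a) (mscale A (y $ k) a)) (madd A (p x) (p y))"
      using p(1) A a by (simp add: q_def ft_hom_def ft_submodule_def ft_module_max_scale)
    also have "\<dots> = madd A (q x) (q y)"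
      unfolding q_def by (intro ft_module_interchange A pA)
    finally show ?thesis .
  qed
  moreover have "q (tscale s x) = mscale A s (q x)" for s x
    using p(1) A a pA
    by (simp add: q_def ft_hom_def ft_submodule_def ft_module_scale_add ft_module_scale_scale)
  ultimately have "q \<in> ft_hom (ft_submodule UNIV) A"
    by (auto simp: ft_hom_def ft_submodule_def)
  moreover have "f (q x) = g (tcomb u (insert k K) (\<lambda>j. x $ j))" for x
  proof -
    have "f (q x) = madd M (mscale M (x $ k) (g (u k))) (g (tcomb u K (\<lambda>j. x $ j)))"
      using f a pA p(2) by (simp add: q_def ft_hom_def)
    also have "\<dots> = g (sup (tscale (x $ k) (u k)) (tcomb u K (\<lambda>j. x $ j)))"
      using g uX by (simp add: ft_hom_def ft_submodule_def)
    finally show ?thesis using insert by (simp add: tcomb_insert)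
  qed
  ultimately show ?case by blast
qed

section \<open>Min-plus convex polytopes are projective\<close>

text \<open>Negation exchanges max and min, so the vector is the componentwise minimum of the
  \<open>G j\<close> scaled by \<open>- l j\<close>.\<close>

lemma min_plus_convex_tcomb_uminus:
  assumes "finite K" "K \<noteq> {}" "min_plus_convex X" "G ` K \<subseteq> X"
  shows "- tcomb (\<lambda>j. - G j) K l \<in> X"
  using assms
proof (induction K rule: finite_ne_induct)
  case (singleton k)
  have "- tcomb (\<lambda>j. - G j) {k} l = tscale (- l k) (G k)"
    by (simp add: tcomb_singleton vec_eq_iff)
  then show ?case using singleton by (simp add: min_plus_convex_def)
next
  case (insert k K)
  have "- tcomb (\<lambda>j. - G j) (insert k K) l =
      inf (tscale (- l k) (G k)) (- tcomb (\<lambda>j. - G j) K l)"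
    using insert.hyps by (simp add: tcomb_insert vec_eq_iff max_def min_def)
  then show ?case using insert by (simp add: min_plus_convex_def)
qed

lemma convex_polytope_coordinates:
  fixes X :: "(real ^ 'n) set"
  assumes X: "tropical_polytope X" and min: "min_plus_convex X"
  obtains u :: "'n \<Rightarrow> real ^ 'n"
  where "range u \<subseteq> X" "\<And>x. x \<in> X \<Longrightarrow> tcomb u UNIV (\<lambda>k. x $ k) = x"
proof -
  obtain S where S: "finite S" "max_plus_convex hull S = X"
    using X by (auto simp: tropical_polytope_def generates_def)
  have ne: "S \<noteq> {}"
    using S X by (auto simp: tropical_polytope_def max_plus_convex_def hull_def)
  have hull: "X = range (tcomb (\<lambda>s. s) S)"
    using max_plus_convex_hull_image[OF S(1) ne, of "\<lambda>s. s"] S(2) by simp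
  have SX: "S \<subseteq> X" using S(2) hull_subset by metis
  \<comment> \<open>Each generator is normalised to have \<open>k\<close>-th coordinate 0;
    \<open>u k\<close> is the minimum of the results.\<close>
  define u where "u k = - tcomb (\<lambda>s. - s) S (\<lambda>s. s $ k)" for k
  have uX: "u k \<in> X" for k
    unfolding u_def using min_plus_convex_tcomb_uminus[OF S(1) ne min, of "\<lambda>s. s"] SX by simp
  have u_le: "u k $ i \<le> s $ i - s $ k" if "s \<in> S" for k i s
    using tcomb_ge[OF S(1) that, of "\<lambda>s. s $ k" "\<lambda>s. - s" i] by (simp add: u_def)
  have u0: "u k $ k = 0" for k
    using tcomb_attained[OF S(1) ne, of "\<lambda>s. - s" "\<lambda>s. s $ k" k] by (auto simp: u_def)
  have lower: "x $ k + u k $ i \<le> x $ i" if "x \<in> X" for x k i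
  proof -
    obtain l where l: "x = tcomb (\<lambda>s. s) S l" using hull \<open>x \<in> X\<close> by blast
    \<comment> \<open>The generator attaining coordinate \<open>k\<close> of \<open>x\<close>
      already forces the bound: its term at \<open>i\<close> is
      \<open>x $ k + s $ i - s $ k\<close>.\<close>
    obtain s where s: "s \<in> S" "x $ k = l s + s $ k"
      using tcomb_attained[OF S(1) ne] l by metis
    have "l s + s $ i \<le> x $ i" using tcomb_ge[OF S(1) s(1), of l "\<lambda>s. s" i] l by simp
    then show ?thesis using u_le[OF s(1), of k i] s(2) by simp
  qed
  show ?thesis
  proof (rule that[of u])
    show "range u \<subseteq> X" using uX by auto
    fix x assume x: "x \<in> X"
    have "tcomb u UNIV (\<lambda>k. x $ k) $ i = x $ i" for i
      by (rule tcomb_nth_eqI[where k = i]) (auto simp: u0 lower[OF x])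
    then show "tcomb u UNIV (\<lambda>k. x $ k) = x" by (simp add: vec_eq_iff)
  qed
qed

lemma min_plus_convex_imp_projective:
  fixes X :: "(real ^ 'n) set"
  assumes X: "tropical_polytope X" and min: "min_plus_convex X"
  shows "ft_projective TYPE('u) (ft_submodule X)"
  unfolding ft_projective_def
proof (intro conjI allI impI ballI)
  have conv: "max_plus_convex X" using X by (rule tropical_polytope_max_plus_convex)
  then show "ft_module (ft_submodule X)" by (rule ft_module_submodule)
  fix A M :: "'u ft_struct" and g f
  assume AM: "ft_module A \<and> ft_module M" and g: "g \<in> ft_hom (ft_submodule X) M"
    and f: "f \<in> ft_hom A M" and surj: "f ` mcarrier A = mcarrier M"
  obtain u where u: "range u \<subseteq> X" "\<And>x. x \<in> X \<Longrightarrow> tcomb u UNIV (\<lambda>k. x $ k) = x"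
    using convex_polytope_coordinates[OF X min] by blast
  obtain p where p: "p \<in> ft_hom (ft_submodule UNIV) A"
      "\<And>x :: real ^ 'n. f (p x) = g (tcomb u UNIV (\<lambda>j. x $ j))"
    using combination_hom[OF _ _ conv u(1) _ f surj g] AM by auto
  \<comment> \<open>The coefficients are the coordinates of \<open>x\<close> themselves, so the
    morphism on the full space need only be restricted to \<open>X\<close>.\<close>
  have "p \<in> ft_hom (ft_submodule X) A"
    using p(1) by (auto simp: ft_hom_def ft_submodule_def)
  then show "\<exists>p\<in>ft_hom (ft_submodule X) A. \<forall>x\<in>mcarrier (ft_submodule X). f (p x) = g x"
    using p(2) u(2) by (intro bexI[of _ p]) (auto simp: ft_submodule_def)
qed

section \<open>Projective polytopes are min-plus convex\<close>

lemma minimal_generators: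
  fixes X :: "(real ^ 'n) set"
  assumes dim: "generator_dimension X = enat CARD('n)"
  obtains G :: "'n \<Rightarrow> real ^ 'n"
  where "range (tcomb G UNIV) = X" "\<And>k. G k \<notin> max_plus_convex hull (G ` (UNIV - {k}))"
proof -
  let ?D = "{enat (card S) | S. finite S \<and> generates S X}"
  have "?D \<noteq> {}"
  proof
    assume "?D = {}"
    then have "generator_dimension X = \<infinity>"
      unfolding generator_dimension_def by (simp add: Inf_enat_def)
    then show False using dim by simp
  qed
  \<comment> \<open>An infimum of a nonempty set of extended naturals is attained, so some
    generating set has exactly \<open>CARD('n)\<close> elements and can be indexed by
    \<open>'n\<close>.\<close>
  then have "Inf ?D \<in> ?D" unfolding Inf_enat_def by (auto intro: LeastI)
  then obtain S where S: "finite S" "generates S X" "card S = CARD('n)"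
    using dim by (auto simp: generator_dimension_def)
  then obtain G :: "'n \<Rightarrow> real ^ 'n" where G: "bij_betw G UNIV S"
    using finite_same_card_bij[of "UNIV :: 'n set" S] by auto
  have GS: "range G = S" using G by (simp add: bij_betw_def)
  show ?thesis
  proof (rule that[of G])
    show "range (tcomb G UNIV) = X"
      using S GS max_plus_convex_hull_image[of UNIV G] by (simp add: generates_def)
    fix k
    show "G k \<notin> max_plus_convex hull (G ` (UNIV - {k}))"
    proof
      let ?T = "G ` (UNIV - {k})"
      assume k: "G k \<in> max_plus_convex hull ?T"
      have "S \<subseteq> max_plus_convex hull ?T"
        using k hull_subset[of ?T max_plus_convex] GS by auto
      then have "max_plus_convex hull S \<subseteq> max_plus_convex hull ?T"
        by (intro hull_minimal max_plus_convex_hull)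
      moreover have "max_plus_convex hull ?T \<subseteq> max_plus_convex hull S"
        by (intro hull_mono) (use GS in auto)
      ultimately have "generates ?T X" using S(2) by (auto simp: generates_def)
      then have "enat (card ?T) \<in> ?D" by auto
      then have "enat CARD('n) \<le> enat (card ?T)"
        using Inf_lower[of "enat (card ?T)" ?D] dim by (simp add: generator_dimension_def)
      also have "card ?T \<le> card (UNIV - {k})" by (intro card_image_le) auto
      then have "enat (card ?T) < enat CARD('n)"
        by (simp add: card_Diff_singleton) (metis One_nat_def Suc_pred le_imp_less_Suc zero_less_card_finite)
      finally show False by simp
    qed
  qed
qed

text \<open>Projectivity lifts the identity of \<open>X\<close> through the surjection from the full
  space onto \<open>X\<close> given by \<open>G\<close>.\<close>

lemma projective_section:
  fixes X :: "(real ^ 'n) set" and G :: "'n \<Rightarrow> real ^ 'n"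
  assumes P: "ft_projective TYPE(real ^ 'n) (ft_submodule X)" and X: "max_plus_convex X"
    and G: "range (tcomb G UNIV) = X"
  obtains p where "p \<in> ft_hom (ft_submodule X) (ft_submodule UNIV)"
    "\<And>x. x \<in> X \<Longrightarrow> tcomb G UNIV (\<lambda>k. p x $ k) = x"
proof -
  let ?A = "ft_submodule UNIV :: (real ^ 'n) ft_struct" and ?X = "ft_submodule X"
  define f where "f y = tcomb G UNIV (\<lambda>k. y $ k)" for y :: "real ^ 'n"
  have f: "f \<in> ft_hom ?A ?X"
    using G by (auto simp: ft_hom_def ft_submodule_def f_def tcomb_sup tscale_tcomb)
  have "tcomb G UNIV l = f (\<chi> k. l k)" for l
    by (simp add: f_def)
  then have "range (tcomb G UNIV) \<subseteq> range f" by blast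
  moreover have "range f \<subseteq> range (tcomb G UNIV)" by (auto simp: f_def)
  ultimately have surj: "f ` mcarrier ?A = mcarrier ?X"
    using G by (simp add: ft_submodule_def)
  have "(\<lambda>x. x) \<in> ft_hom ?X ?X" by (simp add: ft_hom_def)
  moreover have "ft_module ?A" by (rule ft_module_submodule) (simp add: max_plus_convex_def)
  moreover have "ft_module ?X" by (rule ft_module_submodule[OF X])
  ultimately obtain p where "p \<in> ft_hom ?X ?A" "\<forall>x\<in>mcarrier ?X. f (p x) = x"
    using P[unfolded ft_projective_def, THEN conjunct2, rule_format, of ?A ?X "\<lambda>x. x" f] f surj
    by metis
  then show ?thesis using that by (simp add: f_def ft_submodule_def)
qed

lemma section_imp_min_plus_convex:
  fixes X :: "(real ^ 'n) set" and G :: "'n \<Rightarrow> real ^ 'n"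
  assumes X: "max_plus_convex X"
    and G: "range (tcomb G UNIV) = X"
    and irred: "\<And>k. G k \<notin> max_plus_convex hull (G ` (UNIV - {k}))"
    and p: "p \<in> ft_hom (ft_submodule X) (ft_submodule UNIV)"
    and sec: "\<And>x. x \<in> X \<Longrightarrow> tcomb G UNIV (\<lambda>k. p x $ k) = x"
  shows "min_plus_convex X"
proof -
  define P where "P j k = p (G k) $ j" for j k
  have "G ` UNIV \<subseteq> max_plus_convex hull range G" by (rule hull_subset)
  then have GX: "G k \<in> X" for k
    using G max_plus_convex_hull_image[of UNIV G] by auto
  have lower: "P j k + G j $ i \<le> G k $ i" for i j k
    using tcomb_ge[of UNIV j "\<lambda>j. p (G k) $ j" G i] sec[OF GX, of k] by (simp add: P_def)
  \<comment> \<open>By \<open>lower\<close>, \<open>P k k\<close> is at most 0. Were it negative,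
    column \<open>k\<close> would attain no entry in the combination giving \<open>G k\<close>,
    leaving \<open>G k\<close> a combination of the other columns.\<close>
  have diag: "P k k = 0" for k
  proof (rule ccontr)
    assume "P k k \<noteq> 0"
    then have neg: "P k k < 0" using lower[of k k] by (metis add_le_same_cancel2 order_less_le)
    have att: "\<exists>j\<in>UNIV - {k}. P j k + G j $ i = G k $ i" for i
    proof -
      obtain j where "tcomb G UNIV (\<lambda>k'. p (G k) $ k') $ i = p (G k) $ j + G j $ i"
        using tcomb_attained[of UNIV G "\<lambda>k'. p (G k) $ k'" i] by auto
      then have "P j k + G j $ i = G k $ i" using sec[OF GX] by (simp add: P_def)
      then show ?thesis using neg by (intro bexI[of _ j]) auto
    qed
    then have ne: "UNIV - {k} \<noteq> {}" by blast
    have "tcomb G (UNIV - {k}) (\<lambda>j. P j k) $ i = G k $ i" for i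
      using att[of i] tcomb_nth_eqI[OF _ ne, of "\<lambda>j. P j k" G i "G k $ i"] lower by auto
    then have "G k \<in> range (tcomb G (UNIV - {k}))"
      by (metis rangeI vec_eq_iff)
    then show False using irred[of k] max_plus_convex_hull_image[of "UNIV - {k}" G] ne by simp
  qed
  have p_tcomb: "p (tcomb G UNIV l) $ j = tcomb (\<lambda>k. p (G k)) UNIV l $ j" for l j
    using hom_tcomb[OF p X, of UNIV G l] GX by (simp add: image_subset_iff)
  \<comment> \<open>Applying \<open>p\<close> to the section equation shows that \<open>P\<close>
    fixes \<open>p x\<close>; each term of that product is bounded by its value.\<close>
  have star: "P k j + p x $ j \<le> p x $ k" if "x \<in> X" for x j k
    using tcomb_ge[of UNIV j "\<lambda>k. p x $ k" "\<lambda>k. p (G k)" k] p_tcomb[of "\<lambda>k. p x $ k" k] sec[OF that]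
    by (simp add: P_def add.commute)
  \<comment> \<open>Otherwise the element of \<open>X\<close> with coordinates
     \<open>- P k j\<close> would exceed \<open>G k\<close> in all entries, making its \<open>k\<close>-th coordinate \<open>0\<close> positive.\<close>
  have "\<exists>i. \<forall>j. G j $ i = G k $ i + P k j" for k
  proof -
    define x where "x = tcomb G UNIV (\<lambda>j. - P k j)"
    have xX: "x \<in> X" using G x_def by blast
    have "p x $ k \<le> 0"
      unfolding x_def p_tcomb by (auto simp: tcomb_le_iff P_def)
    have "\<exists>i. x $ i \<le> G k $ i"
    proof (rule ccontr)
      assume "\<not> ?thesis"
      then have gt: "G k $ i < x $ i" for i by (meson not_le)
      define \<epsilon> where "\<epsilon> = Min (range (\<lambda>i. x $ i - G k $ i))"
      have \<epsilon>: "\<epsilon> > 0" unfolding \<epsilon>_def using gt by (subst Min_gr_iff) auto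
      have "\<epsilon> \<le> x $ i - G k $ i" for i unfolding \<epsilon>_def by (rule Min_le) auto
      then have "\<epsilon> + G k $ i \<le> x $ i" for i by (smt (verit))
      \<comment> \<open>The order is expressed through \<open>sup\<close>, which \<open>p\<close>
        preserves, so the gap \<open>\<epsilon>\<close> survives in the image.\<close>
      then have "sup (tscale \<epsilon> (G k)) x = x" by (simp add: vec_eq_iff max_def)
      moreover have "tscale \<epsilon> (G k) \<in> X" using X GX by (simp add: max_plus_convex_def)
      ultimately have "p x = sup (tscale \<epsilon> (p (G k))) (p x)"
        using p GX xX by (simp add: ft_hom_def ft_submodule_def) metis
      then have "p x $ k = max (\<epsilon> + P k k) (p x $ k)"
        by (metis P_def sup_vec_nth tscale_nth)
      then show False using \<open>p x $ k \<le> 0\<close> \<epsilon> diag by simp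
    qed
    then obtain i where i: "x $ i \<le> G k $ i" by blast
    \<comment> \<open>The upper bound at \<open>i\<close> meets \<open>lower\<close> for every
      \<open>j\<close>, so row \<open>i\<close> of \<open>G\<close> is row \<open>k\<close> of
      \<open>P\<close> shifted by \<open>G k $ i\<close>.\<close>
    have "G j $ i = G k $ i + P k j" for j
      using tcomb_ge[of UNIV j "\<lambda>j. - P k j" G i] i lower[of k j i] by (simp add: x_def)
    then show ?thesis by blast
  qed
  then obtain r where r: "\<And>k j. G j $ r k = G k $ r k + P k j" by metis
  \<comment> \<open>If one row served both \<open>k\<close> and \<open>k'\<close>, then
    \<open>P k k'\<close> and \<open>P k' k\<close> would cancel, and \<open>lower\<close> in both
    directions would make \<open>G k\<close> a scaling of \<open>G k'\<close>.\<close>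
  have "inj r"
  proof (rule injI, rule ccontr)
    fix k k' assume eq: "r k = r k'" and neq: "k \<noteq> k'"
    have 0: "P k k' + P k' k = 0"
      using r[of k' k] r[of k k'] eq by simp
    have "G k = tscale (P k' k) (G k')"
      using lower[of k' k] lower[of k k'] 0 by (simp add: vec_eq_iff) (smt (verit))
    moreover have "G k' \<in> max_plus_convex hull (G ` (UNIV - {k}))"
      using neq by (intro hull_inc) auto
    ultimately have "G k \<in> max_plus_convex hull (G ` (UNIV - {k}))"
      using max_plus_convex_hull by (metis max_plus_convex_def)
    then show False using irred by simp
  qed
  \<comment> \<open>There are as many generators as coordinates, so every row of \<open>G\<close> is
    reached.\<close>
  then have "surj r" by (simp add: finite_UNIV_inj_surj)
  \<comment> \<open>For \<open>l\<close> obeying the star inequality at \<open>k\<close>, the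
    maximum in row \<open>r k\<close> is attained at the zero diagonal entry of \<open>P\<close>;
    thus \<open>G\<close> only relabels and shifts coordinates.\<close>
  have coord: "tcomb G UNIV l $ r k = G k $ r k + l k" if "\<And>j. P k j + l j \<le> l k" for l k
  proof (rule tcomb_nth_eqI[where k = k])
    show "l j + G j $ r k \<le> G k $ r k + l k" for j
      using that[of j] r[of j k] by linarith
  qed auto
  have "inf x y \<in> X" if xy: "x \<in> X" "y \<in> X" for x y
  proof -
    let ?l = "\<lambda>k. min (p x $ k) (p y $ k)"
    \<comment> \<open>The star inequalities survive minima, so \<open>coord\<close> applies to
      \<open>?l\<close> as well as to \<open>p x\<close> and \<open>p y\<close>.\<close>
    have "P k j + ?l j \<le> ?l k" for k j
      using star[OF xy(1), of k j] star[OF xy(2), of k j] by linarith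
    then have l: "tcomb G UNIV ?l $ r k = G k $ r k + ?l k" for k by (rule coord)
    have "z $ r k = G k $ r k + p z $ k" if "z \<in> X" for z k
      using coord[of k "\<lambda>k. p z $ k"] star[OF that] sec[OF that] by simp
    then have eq: "tcomb G UNIV ?l $ r k = inf x y $ r k" for k
      using l xy by (simp add: min_add_distrib_right)
    have "tcomb G UNIV ?l $ i = inf x y $ i" for i
    proof -
      obtain k where "i = r k" using \<open>surj r\<close> by (rule surjE)
      then show ?thesis using eq by simp
    qed
    then have "tcomb G UNIV ?l = inf x y" by (simp add: vec_eq_iff)
    then show ?thesis using G by (metis rangeI)
  qed
  then show ?thesis using X by (simp add: min_plus_convex_def max_plus_convex_def)
qed

section \<open>The equivalence over any universe containing the reals\<close>

theorem theorem1p4: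
  fixes X :: "(real ^ 'n) set"
  assumes universe: "\<exists>\<iota> :: real \<Rightarrow> 'u. inj \<iota>"
    and "tropical_polytope X"
    and "generator_dimension X = enat CARD('n)"
    and "dual_dimension X = enat CARD('n)"
  shows "ft_projective TYPE('u) (ft_submodule X) \<longleftrightarrow> min_plus_convex X \<and> max_plus_convex X"
proof
  have conv: "max_plus_convex X" using assms(2) by (rule tropical_polytope_max_plus_convex)
  assume P: "ft_projective TYPE('u) (ft_submodule X)"
  \<comment> \<open>The section needs test modules inside \<open>real ^ 'n\<close>, which embeds
    into \<open>'u\<close> by way of \<open>real\<close>.\<close>
  obtain \<iota> :: "real \<Rightarrow> 'u" and e :: "real ^ 'n \<Rightarrow> real" where "inj \<iota>" "inj e"
    using universe inj_vec_real by blast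
  then have P': "ft_projective TYPE(real ^ 'n) (ft_submodule X)"
    using ft_projective_mono[OF inj_compose P] by blast
  obtain G :: "'n \<Rightarrow> real ^ 'n" where G: "range (tcomb G UNIV) = X"
      "\<And>k. G k \<notin> max_plus_convex hull (G ` (UNIV - {k}))"
    using minimal_generators[OF assms(3)] by blast
  then show "min_plus_convex X \<and> max_plus_convex X"
    using section_imp_min_plus_convex[OF conv G] projective_section[OF P' conv G(1)] conv by blast
next
  assume "min_plus_convex X \<and> max_plus_convex X"
  then show "ft_projective TYPE('u) (ft_submodule X)"
    using min_plus_convex_imp_projective assms(2) by blast
qed

end
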